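(* Let $\aleph$ be a Riemannian manifold with maps $E,\eta$ as in the context, let $B\subset\aleph$ be a geodesic local E-invex (GLEI) set with respect to $\eta$, and let $f:\aleph\to\mathbb{R}$ be a geodesic semilocal E-preinvex (GSLEP) function on $B$ with respect to $\eta$. Then the level set $K_\alpha=\{\kappa\in B: f(\kappa)\le\alpha\}$ is a GLEI set with respect to $\eta$ for any $\alpha\in\mathbb{R}$.
   Context: Setting: $\aleph$ is a Riemannian manifold, $E:\aleph\to\aleph$ is a map, and $\eta:\aleph\times\aleph\to T\aleph$ is a map with $\eta(x,y)\in T_y\aleph$. For points $\kappa_1,\kappa_2$, $\gamma_{E(\kappa_1),E(\kappa_2)}:[0,1]\to\aleph$ denotes the (unique) geodesic with $\gamma_{E(\kappa_1),E(\kappa_2)}(0)=E(\kappa_2)$ and initial velocity $\gamma'_{E(\kappa_1),E(\kappa_2)}(0)=\eta(E(\kappa_1),E(\kappa_2))$. GLEI set: a nonempty set $B\subset\aleph$ is geodesic local E-invex with respect to $\eta$ if for all $\kappa_1,\kappa_2\in B$ the geodesic $\gamma_{E(\kappa_1),E(\kappa_2)}:[0,1]\to\aleph$ exists and there is $u(\kappa_1,\kappa_2)\in(0,1]$ such that $\gamma_{E(\kappa_1),E(\kappa_2)}(t)\in B$ for all $t\in[0,u(\kappa_1,\kappa_2)]$. GSLEP function: $f$ is geodesic semilocal E-preinvex on $B$ with respect to $\eta$ if $B$ is a GLEI set and for any $\kappa_1,\kappa_2\in B$ there is $v(\kappa_1,\kappa_2)$ with $0<v(\kappa_1,\kappa_2)\le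 u(\kappa_1,\kappa_2)\le 1$ such that $f(\gamma_{E(\kappa_1),E(\kappa_2)}(t))\le t f(\kappa_1)+(1-t)f(\kappa_2)$ for all $t\in[0,v(\kappa_1,\kappa_2)]$.
   Formalization: The level set K_α is additionally assumed to be nonempty, since GLEI sets are nonempty by definition and the claim fails for any α for which K_α is empty (for example f constant and α below its value). *)

theory Defs
  imports "HOL-Analysis.Analysis"
begin

section \<open>Smooth maps on open subsets of coordinate space\<close>

definition partial_deriv ::
  "'n::finite \<Rightarrow> (real^'n \<Rightarrow> 'c::real_normed_vector) \<Rightarrow> real^'n \<Rightarrow> 'c" where
  "partial_deriv i h x = frechet_derivative h (at x) (axis i 1)"

text \<open>Meaningful for open \<open>S\<close> only: derivatives are taken in the full space. Differentiability of
  all partial derivatives of order at most \<open>k\<close> implies their continuity, hence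
  requiring it for every \<open>k\<close> is the usual notion of a smooth map.\<close>

primrec times_differentiable ::
  "nat \<Rightarrow> (real^'n::finite) set \<Rightarrow> (real^'n \<Rightarrow> 'c::real_normed_vector) \<Rightarrow> bool" where
  "times_differentiable 0 S h \<longleftrightarrow> continuous_on S h"
| "times_differentiable (Suc k) S h \<longleftrightarrow>
     (\<forall>x\<in>S. h differentiable (at x)) \<and> (\<forall>i. times_differentiable k S (partial_deriv i h))"

definition smooth_on :: "(real^'n::finite) set \<Rightarrow> (real^'n \<Rightarrow> 'c::real_normed_vector) \<Rightarrow> bool" where
  "smooth_on S h \<longleftrightarrow> (\<forall>k. times_differentiable k S h)"


section \<open>Smooth manifolds\<close>

text \<open>A chart consists of its domain and its coordinate map; values of the coordinate map outside
  the domain are irrelevant. The dimension of the manifold is \<open>CARD('n)\<close>.\<close>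

type_synonym ('a, 'n) chart = "'a set \<times> ('a \<Rightarrow> real^'n)"

definition chart_on :: "'a topology \<Rightarrow> ('a, 'n::finite) chart \<Rightarrow> bool" where
  "chart_on M c \<longleftrightarrow>
     openin M (fst c) \<and> open (snd c ` fst c) \<and>
     homeomorphic_map (subtopology M (fst c)) (top_of_set (snd c ` fst c)) (snd c)"

definition chart_inv :: "('a, 'n::finite) chart \<Rightarrow> real^'n \<Rightarrow> 'a" where
  "chart_inv c = inv_into (fst c) (snd c)"

definition transition :: "('a, 'n::finite) chart \<Rightarrow> ('a, 'n) chart \<Rightarrow> real^'n \<Rightarrow> real^'n" where
  "transition c d = snd d \<circ> chart_inv c"

definition smooth_manifold :: "'a topology \<Rightarrow> ('a, 'n::finite) chart set \<Rightarrow> bool" where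
  "smooth_manifold M A \<longleftrightarrow>
     Hausdorff_space M \<and> second_countable M \<and>
     (\<forall>c\<in>A. chart_on M c) \<and> (\<Union>c\<in>A. fst c) = topspace M \<and>
     (\<forall>c\<in>A. \<forall>d\<in>A. smooth_on (snd c ` (fst c \<inter> fst d)) (transition c d))"


section \<open>Tangent vectors\<close>

text \<open>A tangent vector at \<open>p\<close> is the family of its coordinate representations in all charts of the
  atlas around \<open>p\<close>, which transform by the Jacobians of the chart transitions. The family is \<open>0\<close>
  at all other indices, so that equality of tangent vectors is equality of families and the
  vector space operations are pointwise.\<close>

type_synonym ('a, 'n) tangent = "('a, 'n) chart \<Rightarrow> real^'n"

definition tangent_space ::
  "('a, 'n::finite) chart set \<Rightarrow> 'a \<Rightarrow> ('a, 'n) tangent set" where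
  "tangent_space A p = {X.
     (\<forall>c. \<not> (c \<in> A \<and> p \<in> fst c) \<longrightarrow> X c = 0) \<and>
     (\<forall>c\<in>A. \<forall>d\<in>A. p \<in> fst c \<and> p \<in> fst d \<longrightarrow>
        X d = frechet_derivative (transition c d) (at (snd c p)) (X c))}"

definition coord_vector ::
  "('a, 'n::finite) chart set \<Rightarrow> ('a, 'n) chart \<Rightarrow> 'n \<Rightarrow> 'a \<Rightarrow> ('a, 'n) tangent" where
  "coord_vector A c i p =
     (\<lambda>d. if d \<in> A \<and> p \<in> fst d then partial_deriv i (transition c d) (snd c p) else 0)"


section \<open>Riemannian metrics\<close>

definition inner_product_on_tangent_space ::
  "('a, 'n::finite) chart set \<Rightarrow> 'a \<Rightarrow> (('a, 'n) tangent \<Rightarrow> ('a, 'n) tangent \<Rightarrow> real) \<Rightarrow> bool" where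
  "inner_product_on_tangent_space A p b \<longleftrightarrow>
     (\<forall>X\<in>tangent_space A p. \<forall>Y\<in>tangent_space A p. b X Y = b Y X) \<and>
     (\<forall>X\<in>tangent_space A p. \<forall>Y\<in>tangent_space A p. \<forall>Z\<in>tangent_space A p.
        b (\<lambda>c. X c + Y c) Z = b X Z + b Y Z) \<and>
     (\<forall>r. \<forall>X\<in>tangent_space A p. \<forall>Y\<in>tangent_space A p. b (\<lambda>c. r *\<^sub>R X c) Y = r * b X Y) \<and>
     (\<forall>X\<in>tangent_space A p. X \<noteq> (\<lambda>c. 0) \<longrightarrow> b X X > 0)"

type_synonym ('a, 'n) metric_tensor = "'a \<Rightarrow> ('a, 'n) tangent \<Rightarrow> ('a, 'n) tangent \<Rightarrow> real"

definition metric_matrix ::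
  "('a, 'n::finite) chart set \<Rightarrow> ('a, 'n) metric_tensor \<Rightarrow> ('a, 'n) chart \<Rightarrow> real^'n \<Rightarrow> real^'n^'n" where
  "metric_matrix A g c x =
     (let p = chart_inv c x in \<chi> i j. g p (coord_vector A c i p) (coord_vector A c j p))"

definition riemannian_manifold ::
  "'a topology \<Rightarrow> ('a, 'n::finite) chart set \<Rightarrow> ('a, 'n) metric_tensor \<Rightarrow> bool" where
  "riemannian_manifold M A g \<longleftrightarrow>
     smooth_manifold M A \<and>
     (\<forall>p\<in>topspace M. inner_product_on_tangent_space A p (g p)) \<and>
     (\<forall>c\<in>A. \<forall>i j. smooth_on (snd c ` fst c) (\<lambda>x. metric_matrix A g c x $ i $ j))"


section \<open>Geodesics of the Levi-Civita connection\<close>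

definition christoffel ::
  "('a, 'n::finite) chart set \<Rightarrow> ('a, 'n) metric_tensor \<Rightarrow> ('a, 'n) chart \<Rightarrow>
   'n \<Rightarrow> 'n \<Rightarrow> 'n \<Rightarrow> real^'n \<Rightarrow> real" where
  "christoffel A g c k i j x =
     (let G = metric_matrix A g c in
       (\<Sum>l\<in>UNIV. matrix_inv (G x) $ k $ l *
          (partial_deriv i (\<lambda>y. G y $ j $ l) x + partial_deriv j (\<lambda>y. G y $ i $ l) x
           - partial_deriv l (\<lambda>y. G y $ i $ j) x)) / 2)"

text \<open>Derivatives of a curve \<open>[0,1] \<rightarrow> M\<close> in a chart; they are one-sided at the endpoints.\<close>

definition coord_velocity ::
  "('a, 'n::finite) chart \<Rightarrow> (real \<Rightarrow> 'a) \<Rightarrow> real \<Rightarrow> real^'n" where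
  "coord_velocity c \<gamma> t = vector_derivative (snd c \<circ> \<gamma>) (at t within {0..1})"

definition coord_acceleration ::
  "('a, 'n::finite) chart \<Rightarrow> (real \<Rightarrow> 'a) \<Rightarrow> real \<Rightarrow> real^'n" where
  "coord_acceleration c \<gamma> t = vector_derivative (coord_velocity c \<gamma>) (at t within {0..1})"

definition geodesic ::
  "'a topology \<Rightarrow> ('a, 'n::finite) chart set \<Rightarrow> ('a, 'n) metric_tensor \<Rightarrow> (real \<Rightarrow> 'a) \<Rightarrow> bool" where
  "geodesic M A g \<gamma> \<longleftrightarrow>
     continuous_map (top_of_set {0..1}) M \<gamma> \<and>
     (\<forall>c\<in>A. \<forall>t\<in>{0..1}. \<gamma> t \<in> fst c \<longrightarrow>
        (snd c \<circ> \<gamma>) differentiable (at t within {0..1}) \<and>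
        coord_velocity c \<gamma> differentiable (at t within {0..1}) \<and>
        (\<forall>k. coord_acceleration c \<gamma> t $ k +
             (\<Sum>i\<in>UNIV. \<Sum>j\<in>UNIV. christoffel A g c k i j (snd c (\<gamma> t)) *
                coord_velocity c \<gamma> t $ i * coord_velocity c \<gamma> t $ j) = 0))"

definition velocity ::
  "('a, 'n::finite) chart set \<Rightarrow> (real \<Rightarrow> 'a) \<Rightarrow> real \<Rightarrow> ('a, 'n) tangent" where
  "velocity A \<gamma> t = (\<lambda>c. if c \<in> A \<and> \<gamma> t \<in> fst c then coord_velocity c \<gamma> t else 0)"


section \<open>Geodesic local E-invexity and semilocal E-preinvexity\<close>

text \<open>The geodesic starts at the \<^emph>\<open>second\<close> point \<open>y\<close>, with initial velocity \<open>\<eta> x y\<close> tangent at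
  \<open>y\<close>. Extensionality makes a curve on \<open>[0,1]\<close> determined by its values there.\<close>

definition is_eta_geodesic ::
  "'a topology \<Rightarrow> ('a, 'n::finite) chart set \<Rightarrow> ('a, 'n) metric_tensor \<Rightarrow>
   ('a \<Rightarrow> 'a \<Rightarrow> ('a, 'n) tangent) \<Rightarrow> 'a \<Rightarrow> 'a \<Rightarrow> (real \<Rightarrow> 'a) \<Rightarrow> bool" where
  "is_eta_geodesic M A g \<eta> x y \<gamma> \<longleftrightarrow>
     \<gamma> \<in> extensional {0..1} \<and> geodesic M A g \<gamma> \<and> \<gamma> 0 = y \<and> velocity A \<gamma> 0 = \<eta> x y"

definition eta_geodesic ::
  "'a topology \<Rightarrow> ('a, 'n::finite) chart set \<Rightarrow> ('a, 'n) metric_tensor \<Rightarrow>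
   ('a \<Rightarrow> 'a \<Rightarrow> ('a, 'n) tangent) \<Rightarrow> 'a \<Rightarrow> 'a \<Rightarrow> real \<Rightarrow> 'a" where
  "eta_geodesic M A g \<eta> x y = (THE \<gamma>. is_eta_geodesic M A g \<eta> x y \<gamma>)"

text \<open>\<open>u\<close> is an admissible choice of \<open>u(\<kappa>1, \<kappa>2)\<close> for the set \<open>B\<close>.\<close>

definition invexity_bound ::
  "'a topology \<Rightarrow> ('a, 'n::finite) chart set \<Rightarrow> ('a, 'n) metric_tensor \<Rightarrow>
   ('a \<Rightarrow> 'a) \<Rightarrow> ('a \<Rightarrow> 'a \<Rightarrow> ('a, 'n) tangent) \<Rightarrow> 'a set \<Rightarrow> 'a \<Rightarrow> 'a \<Rightarrow> real \<Rightarrow> bool" where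
  "invexity_bound M A g E \<eta> B \<kappa>1 \<kappa>2 u \<longleftrightarrow>
     u \<in> {0<..1} \<and> (\<forall>t\<in>{0..u}. eta_geodesic M A g \<eta> (E \<kappa>1) (E \<kappa>2) t \<in> B)"

definition GLEI_set ::
  "'a topology \<Rightarrow> ('a, 'n::finite) chart set \<Rightarrow> ('a, 'n) metric_tensor \<Rightarrow>
   ('a \<Rightarrow> 'a) \<Rightarrow> ('a \<Rightarrow> 'a \<Rightarrow> ('a, 'n) tangent) \<Rightarrow> 'a set \<Rightarrow> bool" where
  "GLEI_set M A g E \<eta> B \<longleftrightarrow>
     B \<noteq> {} \<and> B \<subseteq> topspace M \<and>
     (\<forall>\<kappa>1\<in>B. \<forall>\<kappa>2\<in>B.
        (\<exists>!\<gamma>. is_eta_geodesic M A g \<eta> (E \<kappa>1) (E \<kappa>2) \<gamma>) \<and>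
        (\<exists>u. invexity_bound M A g E \<eta> B \<kappa>1 \<kappa>2 u))"

definition GSLEP_on ::
  "'a topology \<Rightarrow> ('a, 'n::finite) chart set \<Rightarrow> ('a, 'n) metric_tensor \<Rightarrow>
   ('a \<Rightarrow> 'a) \<Rightarrow> ('a \<Rightarrow> 'a \<Rightarrow> ('a, 'n) tangent) \<Rightarrow> 'a set \<Rightarrow> ('a \<Rightarrow> real) \<Rightarrow> bool" where
  "GSLEP_on M A g E \<eta> B f \<longleftrightarrow>
     GLEI_set M A g E \<eta> B \<and>
     (\<forall>\<kappa>1\<in>B. \<forall>\<kappa>2\<in>B. \<exists>u v.
        invexity_bound M A g E \<eta> B \<kappa>1 \<kappa>2 u \<and> 0 < v \<and> v \<le> u \<and>
        (\<forall>t\<in>{0..v}. f (eta_geodesic M A g \<eta> (E \<kappa>1) (E \<kappa>2) t) \<le> t * f \<kappa>1 + (1 - t) * f \<kappa>2))"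

end

theory Submission
  imports Defs
begin

text \<open>Along the geodesic attached to two points of the level set, semilocal preinvexity bounds
  \<open>f\<close> on an initial interval \<open>{0..v}\<close> by convex combinations of two values
  that are at most \<alpha>. The curve therefore stays in the sublevel there, and it stays in
  \<open>B\<close> because v \<le> u. So the preinvexity radius \<open>v\<close> is an invexity
  bound for the level set.\<close>

theorem theorem2p18:
  fixes M :: "'a topology"
    and A :: "('a, 'n::finite) chart set"
    and g :: "('a, 'n) metric_tensor"
    and E :: "'a \<Rightarrow> 'a"
    and \<eta> :: "'a \<Rightarrow> 'a \<Rightarrow> ('a, 'n) tangent"
    and B :: "'a set"
    and f :: "'a \<Rightarrow> real"
    and \<alpha> :: real
  assumes "riemannian_manifold M A g"
    and "E \<in> topspace M \<rightarrow> topspace M"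
    and "\<And>x y. x \<in> topspace M \<Longrightarrow> y \<in> topspace M \<Longrightarrow> \<eta> x y \<in> tangent_space A y"
    and "GLEI_set M A g E \<eta> B"
    and "GSLEP_on M A g E \<eta> B f"
    and "{\<kappa> \<in> B. f \<kappa> \<le> \<alpha>} \<noteq> {}"
  shows "GLEI_set M A g E \<eta> {\<kappa> \<in> B. f \<kappa> \<le> \<alpha>}"
proof -
  let ?K = "{\<kappa> \<in> B. f \<kappa> \<le> \<alpha>}"
  have "\<exists>v. invexity_bound M A g E \<eta> ?K x y v" if K: "x \<in> ?K" "y \<in> ?K" for x y
  proof -
    from assms(5) K obtain u v where u: "invexity_bound M A g E \<eta> B x y u" and v: "0 < v" "v \<le> u"
      and f: "\<And>t. t \<in> {0..v} \<Longrightarrow>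
        f (eta_geodesic M A g \<eta> (E x) (E y) t) \<le> t * f x + (1 - t) * f y"
      unfolding GSLEP_on_def by blast
    from u have u1: "u \<le> 1"
      and B: "\<And>t. t \<in> {0..u} \<Longrightarrow> eta_geodesic M A g \<eta> (E x) (E y) t \<in> B"
      by (auto simp: invexity_bound_def)
    have "eta_geodesic M A g \<eta> (E x) (E y) t \<in> ?K" if t: "t \<in> {0..v}" for t
    proof -
      \<comment> \<open>From t \<le> v \<le> u \<le> 1 the weight \<open>1 - t\<close> is
        nonnegative, so this is a genuine convex combination.\<close>
      have "t * f x + (1 - t) * f y \<le> \<alpha>"
        using K t v u1 by (intro convex_bound_le) auto
      with f[OF t] B[of t] t v show ?thesis by auto
    qed
    with u1 v show ?thesis by (auto simp: invexity_bound_def)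
  qed
  \<comment> \<open>Unique existence of the geodesic depends only on the pair of points, so it
    passes from \<open>B\<close> to the subset.\<close>
  with assms(4,6) show ?thesis by (auto simp: GLEI_set_def)
qed

end
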